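(* Let $d\ge 2$ be a constant. There is a randomized algorithm which, given the vertex set $U(\mathcal{H})$ of a $d$-uniform hypergraph $\mathcal{H}$ (whose hyperedges are unknown), a positive integer $k$, and access to a GPISE oracle for $\mathcal{H}$, makes $\mathcal{O}(k^{2d}\log k)$ GPISE queries and, with probability at least $1-1/k^{c}$ for some constant $c>0$, solves $d$-Hitting-Set: it outputs a set of at most $k$ vertices intersecting every hyperedge of $\mathcal{H}$ if such a set exists, and otherwise reports that no such set exists.
   Context: The GPISE oracle takes as input $d$ pairwise disjoint non-empty subsets $A_1,\dots,A_d\subseteq U(\mathcal{H})$ and returns some hyperedge $\{u_1,\dots,u_d\}$ of $\mathcal{H}$ with $u_i\in A_i$ for all $i$ if one exists (an arbitrary such hyperedge), and NULL otherwise. Only oracle queries are counted. *)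

theory Defs
  imports "HOL-Probability.Probability" "HOL-Library.Landau_Symbols"
begin

definition uniform_hypergraph :: "nat \<Rightarrow> 'v set \<Rightarrow> 'v set set \<Rightarrow> bool" where
  "uniform_hypergraph d U E \<longleftrightarrow> finite U \<and> (\<forall>e\<in>E. e \<subseteq> U \<and> card e = d)"

definition k_hitting_set :: "'v set \<Rightarrow> 'v set set \<Rightarrow> nat \<Rightarrow> 'v set \<Rightarrow> bool" where
  "k_hitting_set U E k S \<longleftrightarrow> S \<subseteq> U \<and> card S \<le> k \<and> (\<forall>e\<in>E. S \<inter> e \<noteq> {})"

text \<open>The output None is the report that no hitting set of size at most k exists.\<close>

definition solves_hitting_set :: "'v set \<Rightarrow> 'v set set \<Rightarrow> nat \<Rightarrow> 'v set option \<Rightarrow> bool" where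
  "solves_hitting_set U E k out \<longleftrightarrow>
     (if \<exists>S. k_hitting_set U E k S
      then \<exists>S. out = Some S \<and> k_hitting_set U E k S
      else out = None)"

text \<open>
  A deterministic query algorithm is a decision tree: inner nodes ask a query and branch on the
  answer. A randomized query algorithm is a probability distribution on such trees.
\<close>

datatype ('q, 'a, 'r) query_alg =
  Return 'r
| Query 'q "'a \<Rightarrow> ('q, 'a, 'r) query_alg"

text \<open>
  A responder sees the transcript of earlier queries and answers besides the current query, so it
  may answer the same query differently at different times. A run returns the output together
  with the transcript, whose length is the number of queries made.
\<close>

type_synonym ('q, 'a) responder = "('q \<times> 'a) list \<Rightarrow> 'q \<Rightarrow> 'a"

primrec run ::
  "('q, 'a) responder \<Rightarrow> ('q, 'a, 'r) query_alg \<Rightarrow> ('q \<times> 'a) list \<Rightarrow> 'r \<times> ('q \<times> 'a) list" where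
  "run orc (Return r) h = (r, h)"
| "run orc (Query q f) h = run orc (f (orc h q)) (h @ [(q, orc h q)])"

definition output_of :: "('q, 'a) responder \<Rightarrow> ('q, 'a, 'r) query_alg \<Rightarrow> 'r" where
  "output_of orc t = fst (run orc t [])"

definition queries_of :: "('q, 'a) responder \<Rightarrow> ('q, 'a, 'r) query_alg \<Rightarrow> 'q list" where
  "queries_of orc t = map fst (snd (run orc t []))"

definition gpise_query :: "nat \<Rightarrow> 'v set \<Rightarrow> 'v set list \<Rightarrow> bool" where
  "gpise_query d U As \<longleftrightarrow> length As = d \<and>
     (\<forall>i<d. As ! i \<noteq> {} \<and> As ! i \<subseteq> U) \<and>
     (\<forall>i<d. \<forall>j<d. i \<noteq> j \<longrightarrow> As ! i \<inter> As ! j = {})"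

definition transversal :: "'v set list \<Rightarrow> 'v set \<Rightarrow> bool" where
  "transversal As e \<longleftrightarrow>
     (\<exists>us. length us = length As \<and> set us = e \<and> (\<forall>i<length As. us ! i \<in> As ! i))"

definition gpise_answer :: "'v set set \<Rightarrow> 'v set list \<Rightarrow> 'v set option \<Rightarrow> bool" where
  "gpise_answer E As ans \<longleftrightarrow>
     (case ans of
        Some e \<Rightarrow> e \<in> E \<and> transversal As e
      | None \<Rightarrow> \<not> (\<exists>e\<in>E. transversal As e))"

definition gpise_oracle ::
  "nat \<Rightarrow> 'v set \<Rightarrow> 'v set set \<Rightarrow> ('v set list, 'v set option) responder \<Rightarrow> bool" where
  "gpise_oracle d U E orc \<longleftrightarrow>
     (\<forall>h As. gpise_query d U As \<longrightarrow> gpise_answer E As (orc h As))"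

type_synonym 'v gpise_alg = "('v set list, 'v set option, 'v set option) query_alg"

end

theory Submission
  imports Defs
begin

text \<open>
  Keep a set \<open>F\<close> of hyperedges found so far and a \<open>k\<close>-hitting set \<open>S\<close> of \<open>F\<close>. If \<open>S\<close> misses a
  hyperedge of \<open>E\<close>, then a uniformly random \<open>d\<close>-colouring of \<open>U - S\<close> gives that hyperedge one
  vertex of each colour with probability at least \<open>1 / d ^ d\<close>, and in this case querying the colour
  classes yields a hyperedge missed by \<open>S\<close>, which is added to \<open>F\<close>. The pairs \<open>(e, S)\<close> of a found
  hyperedge and the hitting set it refutes satisfy a skew intersection condition of Bollobas type,
  so there are at most \<open>(k + 1) ^ d\<close> successful tests. Hence \<open>O(k ^ d)\<close> tests suffice.
\<close>

section \<open>Skew families of set pairs\<close>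

text \<open>The list runs from latest to earliest, so a refuted set is required to meet the
  hyperedges found before it. Nothing is asked of the reverse direction; this one-sidedness is what
  makes the family skew.\<close>

definition skew_pairs :: "nat \<Rightarrow> nat \<Rightarrow> ('v set \<times> 'v set) list \<Rightarrow> bool" where
  "skew_pairs d k xs \<longleftrightarrow>
     (\<forall>(e, S)\<in>set xs. finite e \<and> card e = d \<and> finite S \<and> card S \<le> k \<and> e \<inter> S = {}) \<and>
     sorted_wrt (\<lambda>(e, S) (e', S'). e' \<inter> S \<noteq> {}) xs"

lemma skew_pairs_Cons:
  "skew_pairs d k ((e, S) # xs) \<longleftrightarrow>
     finite e \<and> card e = d \<and> finite S \<and> card S \<le> k \<and> e \<inter> S = {} \<and>
     (\<forall>e'\<in>fst ` set xs. e' \<inter> S \<noteq> {}) \<and> skew_pairs d k xs"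
  unfolding skew_pairs_def by (auto simp: case_prod_beta)

text \<open>Deleting \<open>v\<close> destroys no required intersection: each retained
  \<open>S\<close> is disjoint from its own \<open>e\<close>, which contains \<open>v\<close>, so
  \<open>v\<close> lies outside \<open>S\<close>.\<close>

lemma skew_pairs_link:
  assumes "skew_pairs (Suc d) k xs"
  shows "skew_pairs d k (map (\<lambda>(e, S). (e - {v}, S)) (filter (\<lambda>(e, S). v \<in> e) xs))"
  using assms
proof (induction xs)
  case Nil
  then show ?case by (simp add: skew_pairs_def)
next
  case (Cons x xs)
  obtain e S where x: "x = (e, S)" by (cases x)
  from Cons.prems have xs: "skew_pairs (Suc d) k xs" and e: "finite e" "card e = Suc d"
    and S: "finite S" "card S \<le> k" "e \<inter> S = {}"
    and hit: "\<forall>e'\<in>fst ` set xs. e' \<inter> S \<noteq> {}"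
    by (auto simp: x skew_pairs_Cons)
  show ?case
  proof (cases "v \<in> e")
    case True
    then have "v \<notin> S" using S(3) by blast
    then have "(e' - {v}) \<inter> S \<noteq> {}" if "e' \<in> fst ` set xs" for e'
      using hit that by blast
    then have "\<forall>e'\<in>fst ` set (map (\<lambda>(e, S). (e - {v}, S)) (filter (\<lambda>(e, S). v \<in> e) xs)).
        e' \<inter> S \<noteq> {}"
      by force
    then show ?thesis
      using True e S Cons.IH[OF xs] by (auto simp: x skew_pairs_Cons)
  next
    case False
    then show ?thesis using Cons.IH[OF xs] by (simp add: x)
  qed
qed

lemma length_le_sum_filter:
  assumes "finite S" and "\<And>x. x \<in> set xs \<Longrightarrow> \<exists>v\<in>S. P v x"
  shows "length xs \<le> (\<Sum>v\<in>S. length (filter (P v) xs))"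
  using assms(2)
proof (induction xs)
  case Nil
  then show ?case by simp
next
  case (Cons x xs)
  obtain v where v: "v \<in> S" "P v x"
    using Cons.prems by auto
  have "Suc (length xs) \<le> (\<Sum>v\<in>S. if P v x then 1 else 0) + (\<Sum>v\<in>S. length (filter (P v) xs))"
  proof -
    have "1 \<le> (\<Sum>v\<in>S. if P v x then 1 else (0::nat))"
      using member_le_sum[OF v(1), of "\<lambda>v. if P v x then 1 else (0::nat)"] v(2) assms(1) by simp
    with Cons show ?thesis by fastforce
  qed
  also have "\<dots> = (\<Sum>v\<in>S. length (filter (P v) (x # xs)))"
    by (subst sum.distrib[symmetric]) (auto intro: sum.cong)
  finally show ?case by simp
qed

text \<open>Induction on \<open>d\<close>. The first \<open>S\<close> meets every later hyperedge,
  so the tail is covered by at most \<open>k\<close> links, each bounded by the induction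
  hypothesis; the head adds one more.\<close>

lemma length_skew_pairs_le:
  "skew_pairs d k xs \<Longrightarrow> length xs \<le> (k + 1) ^ d"
proof (induction d arbitrary: xs)
  case 0
  show ?case
  proof (cases xs)
    case (Cons x ys)
    \<comment> \<open>For \<open>d = 0\<close> every \<open>e\<close> is empty, so a second entry
      could not meet the first \<open>S\<close>.\<close>
    then show ?thesis
      using 0 by (cases ys) (auto simp: skew_pairs_def)
  qed simp
next
  case (Suc d)
  show ?case
  proof (cases xs)
    case (Cons x ys)
    obtain e S where x: "x = (e, S)" by (cases x)
    from Suc.prems have ys: "skew_pairs (Suc d) k ys" and S: "finite S" "card S \<le> k"
      and hit: "\<forall>e'\<in>fst ` set ys. e' \<inter> S \<noteq> {}"
      by (auto simp: Cons x skew_pairs_Cons)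
    have "length ys \<le> (\<Sum>v\<in>S. length (filter (\<lambda>(e, S). v \<in> e) ys))"
      using hit by (intro length_le_sum_filter S) fastforce
    also have "\<dots> \<le> (\<Sum>v\<in>S. (k + 1) ^ d)"
      using Suc.IH[OF skew_pairs_link[OF ys]] by (intro sum_mono) simp
    also have "\<dots> \<le> k * (k + 1) ^ d"
      using S by simp
    finally have "length ys \<le> k * (k + 1) ^ d" .
    moreover have "length xs = length ys + 1" "1 \<le> (k + 1) ^ d"
      "(k + 1) ^ Suc d = k * (k + 1) ^ d + (k + 1) ^ d"
      by (simp_all add: Cons)
    ultimately show ?thesis by linarith
  qed simp
qed

section \<open>The algorithm\<close>

text \<open>Only queries are counted, so the hitting set may be picked by \<open>SOME\<close>. The
  pick depends on \<open>F\<close> alone and stays fixed as long as no hyperedge is added.\<close>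

definition candidate :: "'v set \<Rightarrow> 'v set set \<Rightarrow> nat \<Rightarrow> 'v set option" where
  "candidate U F k =
     (if \<exists>S. k_hitting_set U F k S then Some (SOME S. k_hitting_set U F k S) else None)"

lemma candidate_SomeD: "candidate U F k = Some S \<Longrightarrow> k_hitting_set U F k S"
  unfolding candidate_def by (metis option.distinct(1) option.inject someI_ex)

lemma candidate_NoneD: "candidate U F k = None \<Longrightarrow> \<not> k_hitting_set U F k S"
  unfolding candidate_def by (metis option.distinct(1))

text \<open>A hitting set of \<open>E\<close> also hits \<open>F\<close>, so the answer
  \<open>None\<close> is always right, and a candidate is wrong only if it misses a
  hyperedge.\<close>

lemma solves_candidate_iff:
  assumes "F \<subseteq> E"
  shows "solves_hitting_set U E k (candidate U F k) \<longleftrightarrow>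
    (\<forall>S. candidate U F k = Some S \<longrightarrow> (\<forall>e\<in>E. S \<inter> e \<noteq> {}))"
proof (cases "candidate U F k")
  case None
  then have "\<not> k_hitting_set U E k S" for S
    using candidate_NoneD[OF None, of S] assms unfolding k_hitting_set_def by blast
  with None show ?thesis by (simp add: solves_hitting_set_def)
next
  case (Some S)
  then show ?thesis
    using candidate_SomeD[OF Some] unfolding solves_hitting_set_def k_hitting_set_def by auto
qed

definition colour_classes :: "nat \<Rightarrow> 'v set \<Rightarrow> ('v \<Rightarrow> nat) \<Rightarrow> 'v set list" where
  "colour_classes d V c = map (\<lambda>i. {v\<in>V. c v = i}) [0..<d]"

lemma transversal_colour_classes_iff:
  "transversal (colour_classes d V c) e \<longleftrightarrow> e \<subseteq> V \<and> bij_betw c e {..<d}"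
proof
  assume "transversal (colour_classes d V c) e"
  then obtain us where us: "length us = d" "set us = e"
    "\<And>i. i < d \<Longrightarrow> us ! i \<in> V \<and> c (us ! i) = i"
    unfolding transversal_def colour_classes_def by auto
  then have "bij_betw c e {..<d}"
    by (intro bij_betwI[where g = "\<lambda>i. us ! i"]) (auto simp: in_set_conv_nth)
  with us show "e \<subseteq> V \<and> bij_betw c e {..<d}"
    by (auto simp: in_set_conv_nth)
next
  assume *: "e \<subseteq> V \<and> bij_betw c e {..<d}"
  \<comment> \<open>List \<open>e\<close> in the order of its colours.\<close>
  define us where "us = map (inv_into e c) [0..<d]"
  have inv: "inv_into e c i \<in> e" "c (inv_into e c i) = i" if "i < d" for i
    using * that by (auto simp: bij_betw_def inv_into_into f_inv_into_f)
  have "set us = inv_into e c ` {..<d}"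
    by (simp add: us_def atLeast0LessThan)
  also have "\<dots> = e"
    using * by (metis bij_betw_imp_surj_on bij_betw_inv_into)
  finally show "transversal (colour_classes d V c) e"
    unfolding transversal_def using * inv
    by (intro exI[of _ us]) (auto simp: us_def colour_classes_def)
qed

text \<open>A transversal puts a vertex into every class. Hence a colouring with an empty class,
  which gives no legal query, can be skipped without losing a hyperedge.\<close>

lemma gpise_query_colour_classesI:
  assumes "transversal (colour_classes d V c) e" "V \<subseteq> U"
  shows "gpise_query d U (colour_classes d V c)"
  using assms unfolding gpise_query_def transversal_def
  by (force simp: colour_classes_def)

text \<open>
  The state \<open>xs\<close> lists, latest first, the found hyperedges together with the candidate each of them
  refuted. The colourings are drawn in advance, since an inner node of a tree cannot toss coins.
\<close>

primrec search ::
  "nat \<Rightarrow> 'v set \<Rightarrow> nat \<Rightarrow> ('v \<Rightarrow> nat) list \<Rightarrow> ('v set \<times> 'v set) list \<Rightarrow> 'v gpise_alg"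
where
  "search d U k [] xs = Return (candidate U (fst ` set xs) k)"
| "search d U k (c # cs) xs =
     (case candidate U (fst ` set xs) k of
        None \<Rightarrow> Return None
      | Some S \<Rightarrow>
          (if gpise_query d U (colour_classes d (U - S) c)
           then Query (colour_classes d (U - S) c)
             (\<lambda>ans. search d U k cs (case ans of None \<Rightarrow> xs | Some e \<Rightarrow> (e, S) # xs))
           else search d U k cs xs))"

lemma run_search_queries:
  "\<exists>ts. snd (run orc (search d U k cs xs) h) = h @ ts \<and> length ts \<le> length cs \<and>
     (\<forall>(As, ans)\<in>set ts. gpise_query d U As)"
proof (induction cs arbitrary: xs h)
  case Nil
  show ?case by simp
next
  case (Cons c cs)
  show ?case
  proof (cases "candidate U (fst ` set xs) k")
    case None
    then show ?thesis by simp
  next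
    case (Some S)
    let ?As = "colour_classes d (U - S) c"
    let ?xs = "case orc h ?As of None \<Rightarrow> xs | Some e \<Rightarrow> (e, S) # xs"
    show ?thesis
    proof (cases "gpise_query d U ?As")
      case True
      obtain ts where "snd (run orc (search d U k cs ?xs) (h @ [(?As, orc h ?As)])) =
          (h @ [(?As, orc h ?As)]) @ ts" "length ts \<le> length cs"
          "\<forall>(As, ans)\<in>set ts. gpise_query d U As"
        using Cons.IH by blast
      then show ?thesis
        using True Some by (intro exI[of _ "(?As, orc h ?As) # ts"]) simp
    next
      case False
      obtain ts where "snd (run orc (search d U k cs xs) h) = h @ ts" "length ts \<le> length cs"
          "\<forall>(As, ans)\<in>set ts. gpise_query d U As"
        using Cons.IH by blast
      then show ?thesis
        using False Some by (intro exI[of _ ts]) simp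
    qed
  qed
qed

lemma queries_of_search:
  "length (queries_of orc (search d U k cs xs)) \<le> length cs"
  "\<forall>As\<in>set (queries_of orc (search d U k cs xs)). gpise_query d U As"
  using run_search_queries[of orc d U k cs xs "[]"] unfolding queries_of_def by auto

section \<open>Failure probability\<close>

text \<open>Conditioning on the first draw, for the induction on the number of colourings.\<close>

lemma measure_replicate_pmf_Suc:
  "measure_pmf.prob (replicate_pmf (Suc n) p) {xs. P xs} =
     (\<integral>x. measure_pmf.prob (replicate_pmf n p) {xs. P (x # xs)} \<partial>measure_pmf p)"
proof -
  have "measure_pmf.prob (bind_pmf p f) A = (\<integral>x. measure_pmf.prob (f x) A \<partial>measure_pmf p)"
    for f :: "'a \<Rightarrow> 'a list pmf" and A
    by (simp add: measure_pmf_bind measure_pmf.measure_bind[where N = "count_space UNIV"]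
        measure_subprob)
  then show ?thesis
    unfolding replicate_pmf.simps map_pmf_def[symmetric] by (simp add: vimage_def)
qed

lemma
  fixes b r :: real
  shows integrable_affine_indicator:
      "integrable (measure_pmf p) (\<lambda>x. b * (1 - indicator G x / r))"
    and integral_affine_indicator:
      "(\<integral>x. b * (1 - indicator G x / r) \<partial>measure_pmf p) = b * (1 - measure_pmf.prob p G / r)"
proof -
  have ind: "integrable (measure_pmf p) (indicator G :: _ \<Rightarrow> real)"
    by (rule measure_pmf.integrable_const_bound[where B = 1]) auto
  then have div: "integrable (measure_pmf p) (\<lambda>x. indicator G x / r)"
    by (rule integrable_divide_zero)
  then show "integrable (measure_pmf p) (\<lambda>x. b * (1 - indicator G x / r))"
    by (intro integrable_mult_right Bochner_Integration.integrable_diff) simp_all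
  have "(\<integral>x. 1 - indicator G x / r \<partial>measure_pmf p) = 1 - measure_pmf.prob p G / r"
    using div by (subst Bochner_Integration.integral_diff) simp_all
  then show "(\<integral>x. b * (1 - indicator G x / r) \<partial>measure_pmf p) = b * (1 - measure_pmf.prob p G / r)"
    by simp
qed

section \<open>Runs against a fixed oracle\<close>

locale hypergraph_oracle =
  fixes d :: nat and U :: "'v set" and E :: "'v set set" and k :: nat
    and orc :: "('v set list, 'v set option) responder"
  assumes uniform: "uniform_hypergraph d U E"
    and responds: "gpise_oracle d U E orc"
begin

definition valid_state :: "('v set \<times> 'v set) list \<Rightarrow> bool" where
  "valid_state xs \<longleftrightarrow> fst ` set xs \<subseteq> E \<and> skew_pairs d k xs"

text \<open>The transcript \<open>h\<close> is a parameter because answers may depend on it. Bounds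
  valid for every \<open>h\<close> cover history-dependent responders.\<close>

definition fails :: "('v set \<times> 'v set) list \<Rightarrow> ('v set list \<times> 'v set option) list \<Rightarrow>
    ('v \<Rightarrow> nat) list \<Rightarrow> bool" where
  "fails xs h cs \<longleftrightarrow> \<not> solves_hitting_set U E k (fst (run orc (search d U k cs xs) h))"

text \<open>All of \<open>U\<close> is coloured, since the draw precedes the choice of
  \<open>S\<close>; restricting to \<open>U - S\<close> keeps the colours uniform and independent.
  Outside \<open>U\<close> the value is the default 0.\<close>

abbreviation colouring :: "('v \<Rightarrow> nat) pmf" where
  "colouring \<equiv> Pi_pmf U 0 (\<lambda>_. pmf_of_set {..<d})"

lemma finite_U: "finite U"
  and edgeD: "e \<in> E \<Longrightarrow> e \<subseteq> U" "e \<in> E \<Longrightarrow> card e = d"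
  using uniform unfolding uniform_hypergraph_def by auto

lemma answer:
  assumes "gpise_query d U As"
  shows "orc h As = Some e \<Longrightarrow> e \<in> E \<and> transversal As e"
    and "orc h As = None \<Longrightarrow> e \<in> E \<Longrightarrow> \<not> transversal As e"
proof -
  have "gpise_answer E As (orc h As)"
    using responds assms by (simp add: gpise_oracle_def)
  then show "orc h As = Some e \<Longrightarrow> e \<in> E \<and> transversal As e"
    and "orc h As = None \<Longrightarrow> e \<in> E \<Longrightarrow> \<not> transversal As e"
    by (auto simp: gpise_answer_def)
qed

lemma valid_state_step:
  assumes "valid_state xs" "candidate U (fst ` set xs) k = Some S"
    and "gpise_query d U (colour_classes d (U - S) c)"
    and "orc h (colour_classes d (U - S) c) = Some e"
  shows "valid_state ((e, S) # xs)"
proof -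
  have e: "e \<in> E" "e \<subseteq> U - S"
    using answer(1)[OF assms(3,4)] by (auto simp: transversal_colour_classes_iff)
  have S: "k_hitting_set U (fst ` set xs) k S"
    by (rule candidate_SomeD[OF assms(2)])
  then have S': "card S \<le> k" "finite S" "\<forall>e'\<in>fst ` set xs. e' \<inter> S \<noteq> {}"
    using finite_U by (auto simp: k_hitting_set_def Int_commute intro: finite_subset)
  have "finite e" "card e = d" "e \<inter> S = {}"
    using e edgeD[OF e(1)] finite_U by (auto intro: finite_subset)
  with e(1) S' assms(1) show ?thesis
    by (simp add: valid_state_def skew_pairs_Cons)
qed

lemma not_fails:
  assumes "valid_state xs" "solves_hitting_set U E k (candidate U (fst ` set xs) k)"
  shows "\<not> fails xs h cs"
proof (induction cs arbitrary: h)
  case Nil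
  show ?case using assms by (simp add: fails_def)
next
  case (Cons c cs)
  show ?case
  proof (cases "candidate U (fst ` set xs) k")
    case None
    then show ?thesis using assms by (simp add: fails_def)
  next
    case (Some S)
    let ?As = "colour_classes d (U - S) c"
    have hit: "\<forall>e\<in>E. S \<inter> e \<noteq> {}"
      using assms Some solves_candidate_iff[of "fst ` set xs" E U k] by (simp add: valid_state_def)
    \<comment> \<open>The classes avoid \<open>S\<close>, which hits every hyperedge, so no
      hyperedge can be returned and the state never changes again.\<close>
    have "orc h ?As = None" if "gpise_query d U ?As"
    proof (cases "orc h ?As")
      case (Some e)
      from answer(1)[OF that Some] hit show ?thesis
        by (auto simp: transversal_colour_classes_iff)
    qed
    then show ?thesis
      using Cons.IH Some by (simp add: fails_def)
  qed
qed

text \<open>It suffices to fix one bijection \<open>g\<close>: a colouring agrees with it on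
  \<open>e\<close> with probability exactly \<open>1 / d ^ d\<close>.\<close>

lemma prob_rainbow_ge:
  assumes "e \<in> E" "d > 0"
  shows "measure_pmf.prob colouring {c. bij_betw c e {..<d}} \<ge> 1 / real d ^ d"
proof -
  have e: "e \<subseteq> U" "card e = d" "finite e"
    using edgeD assms finite_U finite_subset by blast+
  obtain g where g: "bij_betw g e {..<d}"
    using e finite_same_card_bij[of e "{..<d}"] by auto
  let ?B = "\<lambda>v. if v \<in> e then {g v} else UNIV"
  have "1 / real d ^ d = (\<Prod>v\<in>e. 1 / real d)"
    using e by (simp add: power_one_over)
  also have "\<dots> = (\<Prod>v\<in>e. measure_pmf.prob (pmf_of_set {..<d}) (?B v))"
  proof (rule prod.cong)
    fix v assume v: "v \<in> e"
    then have "g v < d" using g bij_betwE by blast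
    then have "pmf (pmf_of_set {..<d}) (g v) = 1 / real d"
      by (subst pmf_of_set) auto
    then show "1 / real d = measure_pmf.prob (pmf_of_set {..<d}) (?B v)"
      using v by (simp add: measure_pmf_single)
  qed simp
  also have "\<dots> = (\<Prod>v\<in>U. measure_pmf.prob (pmf_of_set {..<d}) (?B v))"
    using e(1) by (intro prod.mono_neutral_left finite_U) simp_all
  also have "\<dots> = measure_pmf.prob colouring (Pi U ?B)"
    by (rule measure_Pi_pmf_Pi[OF finite_U, symmetric])
  also have "\<dots> \<le> measure_pmf.prob colouring {c. bij_betw c e {..<d}}"
  proof (rule measure_pmf.finite_measure_mono)
    have "bij_betw c e {..<d}" if "c \<in> Pi U ?B" for c
    proof -
      have "c v = g v" if "v \<in> e" for v
        using Pi_mem[OF \<open>c \<in> Pi U ?B\<close>, of v] that e by auto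
      then show ?thesis using g bij_betw_cong[of e c g "{..<d}"] by simp
    qed
    then show "Pi U ?B \<subseteq> {c. bij_betw c e {..<d}}" by blast
  qed simp
  finally show ?thesis .
qed

text \<open>
  The weight \<open>2 ^ r\<close>, where \<open>r\<close> bounds the number of further successful tests, makes the bound
  multiplicative: a success halves it, and a failure leaves it unchanged.
\<close>

lemma prob_fails_le:
  assumes "valid_state xs" "d > 0"
  shows "measure_pmf.prob (replicate_pmf L colouring) {cs. fails xs h cs}
    \<le> 2 ^ ((k + 1) ^ d - length xs) * (1 - 1 / (2 * real d ^ d)) ^ L"
  using assms(1)
proof (induction L arbitrary: xs h)
  case 0
  have "measure_pmf.prob (replicate_pmf 0 colouring) {cs. fails xs h cs} \<le> 1"
    by simp
  also have "\<dots> \<le> 2 ^ ((k + 1) ^ d - length xs)"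
    by simp
  finally show ?case by simp
next
  case (Suc L)
  \<comment> \<open>The expected factor per test: with probability at least \<open>1 / d ^ d\<close>
    the weight is halved.\<close>
  define a where "a = 1 - 1 / (2 * real d ^ d)"
  define r where "r = (k + 1) ^ d - length xs"
  have a: "0 \<le> a"
  proof -
    have "1 \<le> real d ^ d" using assms(2) by simp
    then show ?thesis unfolding a_def by (simp add: divide_simps)
  qed
  show ?case
  proof (cases "solves_hitting_set U E k (candidate U (fst ` set xs) k)")
    case True
    then have "{cs. fails xs h cs} = {}" using not_fails Suc.prems by blast
    then show ?thesis using a by (simp add: a_def del: replicate_pmf.simps)
  next
    case False
    with Suc.prems obtain S e where S: "candidate U (fst ` set xs) k = Some S"
      and e: "e \<in> E" "S \<inter> e = {}"
      using solves_candidate_iff[of "fst ` set xs" E U k] unfolding valid_state_def by blast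
    define G where "G = {c :: 'v \<Rightarrow> nat. bij_betw c e {..<d}}"
    \<comment> \<open>Rainbow colourings of the one missed hyperedge \<open>e\<close> force a
      success. A test may also succeed outside \<open>G\<close>, where the factor 1/2 is still below
      the claimed 1.\<close>
    have step: "measure_pmf.prob (replicate_pmf L colouring) {cs. fails xs h (c # cs)}
        \<le> 2 ^ r * a ^ L * (1 - indicator G c / 2)" for c
    proof -
      let ?As = "colour_classes d (U - S) c"
      show ?thesis
      proof (cases "gpise_query d U ?As \<and> orc h ?As \<noteq> None")
        case True
        then obtain e' where q: "gpise_query d U ?As" and ans: "orc h ?As = Some e'"
          by blast
        have valid: "valid_state ((e', S) # xs)"
          by (rule valid_state_step[OF Suc.prems S q ans])
        \<comment> \<open>This keeps the truncated subtraction honest: the exponent really drops by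
          one.\<close>
        have "length ((e', S) # xs) \<le> (k + 1) ^ d"
          using valid length_skew_pairs_le unfolding valid_state_def by blast
        then have r: "r = Suc ((k + 1) ^ d - length ((e', S) # xs))"
          by (simp add: r_def)
        have "measure_pmf.prob (replicate_pmf L colouring) {cs. fails xs h (c # cs)} =
            measure_pmf.prob (replicate_pmf L colouring)
              {cs. fails ((e', S) # xs) (h @ [(?As, Some e')]) cs}"
          by (simp add: fails_def S q ans)
        also have "\<dots> \<le> 2 ^ ((k + 1) ^ d - length ((e', S) # xs)) * a ^ L"
          unfolding a_def by (rule Suc.IH[OF valid])
        also have "\<dots> = 2 ^ r * a ^ L * (1 - 1 / 2)"
          by (simp add: r)
        also have "\<dots> \<le> 2 ^ r * a ^ L * (1 - indicator G c / 2)"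
          using a by (intro mult_left_mono) (auto simp: indicator_def)
        finally show ?thesis .
      next
        case False
        have "c \<notin> G"
        proof
          assume "c \<in> G"
          then have t: "transversal ?As e"
            using e edgeD(1)[OF e(1)] by (auto simp: transversal_colour_classes_iff G_def)
          then have "gpise_query d U ?As" by (rule gpise_query_colour_classesI) auto
          with False t e(1) answer(2) show False by blast
        qed
        \<comment> \<open>An unsuccessful test leaves the state alone and at most extends the
          transcript.\<close>
        moreover have "\<exists>h'. \<forall>cs. fails xs h (c # cs) = fails xs h' cs"
          using False S by (cases "gpise_query d U ?As") (auto simp: fails_def)
        then obtain h' where "\<forall>cs. fails xs h (c # cs) = fails xs h' cs" by blast
        ultimately show ?thesis
          using Suc.IH[OF Suc.prems, of h'] by (simp add: r_def a_def)
      qed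
    qed
    have "measure_pmf.prob (replicate_pmf (Suc L) colouring) {cs. fails xs h cs} =
        (\<integral>c. measure_pmf.prob (replicate_pmf L colouring) {cs. fails xs h (c # cs)} \<partial>colouring)"
      by (rule measure_replicate_pmf_Suc)
    also have "\<dots> \<le> (\<integral>c. 2 ^ r * a ^ L * (1 - indicator G c / 2) \<partial>colouring)"
    proof (rule integral_mono)
      show "integrable colouring
          (\<lambda>c. measure_pmf.prob (replicate_pmf L colouring) {cs. fails xs h (c # cs)})"
        by (rule measure_pmf.integrable_const_bound[where B = 1]) auto
      show "integrable colouring (\<lambda>c. 2 ^ r * a ^ L * (1 - indicator G c / 2) :: real)"
        by (rule integrable_affine_indicator)
    qed (rule step)
    also have "\<dots> = 2 ^ r * a ^ L * (1 - measure_pmf.prob colouring G / 2)"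
      by (rule integral_affine_indicator)
    also have "\<dots> \<le> 2 ^ r * a ^ L * a"
      using prob_rainbow_ge[OF e(1) assms(2)] a unfolding G_def
      by (intro mult_left_mono) (simp_all add: a_def)
    finally show ?thesis
      unfolding a_def r_def by (simp only: power_Suc2 mult.assoc)
  qed
qed

end

section \<open>Number of tests: error bound and growth\<close>

definition num_tests :: "nat \<Rightarrow> nat \<Rightarrow> nat" where
  "num_tests d k = 4 * d ^ d * (k + 1) ^ d"

text \<open>With \<open>M = (k + 1) ^ d\<close>, the factor 4 in \<open>num_tests\<close> turns
  \<open>1 - x \<le> exp (- x)\<close> into the bound \<open>exp (- 2 * M)\<close>. This absorbs
  \<open>2 ^ M \<le> exp M\<close> and leaves \<open>exp (- M)\<close>, which is at most
  \<open>1 / k\<close>.\<close>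

lemma failure_bound_le:
  assumes "d > 0" "k \<ge> 1"
  shows "2 ^ ((k + 1) ^ d) * (1 - 1 / (2 * real d ^ d)) ^ num_tests d k \<le> 1 / real k"
proof -
  define M where "M = (k + 1) ^ d"
  define D where "D = real d ^ d"
  have D: "D \<ge> 1" using assms by (simp add: D_def)
  have M: "k \<le> M" using assms self_le_power[of "k + 1" d] by (simp add: M_def)
  have "(1 - 1 / (2 * D)) ^ num_tests d k \<le> exp (- (1 / (2 * D))) ^ num_tests d k"
    using D exp_ge_add_one_self[of "- (1 / (2 * D))"]
    by (intro power_mono) (auto simp: divide_simps)
  also have "\<dots> = exp (real (num_tests d k) * - (1 / (2 * D)))"
    by (rule exp_of_nat_mult[symmetric])
  also have "real (num_tests d k) = 4 * D * real M"
    by (simp add: num_tests_def M_def D_def)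
  also have "4 * D * real M * - (1 / (2 * D)) = - 2 * real M"
    using D by simp
  finally have 1: "(1 - 1 / (2 * D)) ^ num_tests d k \<le> exp (- 2 * real M)" .
  have "(2::real) ^ M \<le> exp 1 ^ M"
    using exp_ge_add_one_self[of 1] by (intro power_mono) auto
  also have "\<dots> = exp (real M)"
    using exp_of_nat_mult[of M "1::real"] by simp
  finally have "2 ^ M * (1 - 1 / (2 * D)) ^ num_tests d k \<le> exp (real M) * exp (- 2 * real M)"
    using 1 D by (intro mult_mono) (auto simp: divide_simps)
  also have "\<dots> = exp (- real M)"
    unfolding mult_exp_exp by simp
  also have "\<dots> = 1 / exp (real M)"
    by (simp only: exp_minus inverse_eq_divide)
  also have "\<dots> \<le> 1 / real k"
  proof -
    have "real k \<le> exp (real M)"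
      using M exp_ge_add_one_self[of "real M"] by linarith
    then show ?thesis using assms by (intro divide_left_mono) auto
  qed
  finally show ?thesis by (simp add: M_def D_def)
qed

lemma num_tests_bigo:
  "(\<lambda>k. real (num_tests d k)) \<in> O(\<lambda>k. real k ^ (2 * d) * ln (real k))"
proof (rule bigoI)
  show "\<forall>\<^sub>F k in at_top. norm (real (num_tests d k)) \<le>
      (4 * real d ^ d * 2 ^ d) * norm (real k ^ (2 * d) * ln (real k))"
    \<comment> \<open>From 3 on, \<open>k\<close> exceeds \<open>exp 1\<close>, so the logarithm is
      at least 1 and \<open>k ^ d\<close> is below the target.\<close>
    using eventually_ge_at_top[of "3::nat"]
  proof eventually_elim
    case (elim k)
    have "exp 1 \<le> real k" using exp_le elim by linarith
    then have ln: "1 \<le> ln (real k)" using elim by (subst ln_ge_iff) auto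
    have "real (k + 1) ^ d \<le> (2 * real k) ^ d"
      using elim by (intro power_mono) auto
    also have "\<dots> \<le> 2 ^ d * (real k ^ (2 * d) * ln (real k))"
    proof -
      have "real k ^ d * 1 \<le> real k ^ (2 * d) * ln (real k)"
        using elim ln by (intro mult_mono power_increasing) auto
      then show ?thesis by (simp add: power_mult_distrib)
    qed
    finally have "4 * real d ^ d * real (k + 1) ^ d \<le>
        4 * real d ^ d * (2 ^ d * (real k ^ (2 * d) * ln (real k)))"
      by (intro mult_left_mono) auto
    then show ?case
      using ln by (simp add: num_tests_def abs_mult mult.assoc add.commute)
  qed
qed

theorem theorem5:
  fixes d :: nat
  assumes "d \<ge> 2"
  shows "\<exists>(Alg :: 'v set \<Rightarrow> nat \<Rightarrow> 'v gpise_alg pmf) (T :: nat \<Rightarrow> nat) (c :: real).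
           (\<lambda>k. real (T k)) \<in> O(\<lambda>k. real k ^ (2 * d) * ln (real k)) \<and> c > 0 \<and>
           (\<forall>U E k orc. k \<ge> 1 \<longrightarrow> uniform_hypergraph d U E \<longrightarrow> gpise_oracle d U E orc \<longrightarrow>
              (\<forall>t\<in>set_pmf (Alg U k).
                 (\<forall>As\<in>set (queries_of orc t). gpise_query d U As) \<and>
                 length (queries_of orc t) \<le> T k) \<and>
              measure_pmf.prob (Alg U k) {t. solves_hitting_set U E k (output_of orc t)}
                \<ge> 1 - 1 / real k powr c)"
proof -
  \<comment> \<open>\<open>C\<close> is the law of the advance coin tosses; \<open>Alg\<close> is
    its image on decision trees.\<close>
  define C :: "'v set \<Rightarrow> nat \<Rightarrow> ('v \<Rightarrow> nat) list pmf" where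
    "C = (\<lambda>U k. replicate_pmf (num_tests d k) (Pi_pmf U 0 (\<lambda>_. pmf_of_set {..<d})))"
  define Alg :: "'v set \<Rightarrow> nat \<Rightarrow> 'v gpise_alg pmf" where
    "Alg = (\<lambda>U k. map_pmf (\<lambda>cs. search d U k cs []) (C U k))"
  have queries: "(\<forall>As\<in>set (queries_of orc t). gpise_query d U As) \<and>
      length (queries_of orc t) \<le> num_tests d k" if "t \<in> set_pmf (Alg U k)" for U k orc t
  proof -
    from that obtain cs where "t = search d U k cs []" "length cs = num_tests d k"
      by (auto simp: Alg_def C_def set_replicate_pmf)
    then show ?thesis using queries_of_search by metis
  qed
  \<comment> \<open>The failure bound \<open>1 / k\<close> allows the exponent
    \<open>c = 1\<close>.\<close>
  have success: "measure_pmf.prob (Alg U k) {t. solves_hitting_set U E k (output_of orc t)}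
      \<ge> 1 - 1 / real k powr 1"
    if k: "k \<ge> 1" and "uniform_hypergraph d U E" "gpise_oracle d U E orc" for U E k orc
  proof -
    interpret hypergraph_oracle d U E k orc
      using that by unfold_locales
    have "valid_state []" by (simp add: valid_state_def skew_pairs_def)
    then have "measure_pmf.prob (C U k) {cs. fails [] [] cs} \<le>
        2 ^ ((k + 1) ^ d - length ([] :: ('v set \<times> 'v set) list)) *
        (1 - 1 / (2 * real d ^ d)) ^ num_tests d k"
      unfolding C_def by (rule prob_fails_le) (use assms in linarith)
    also have "\<dots> \<le> 1 / real k"
      unfolding list.size diff_zero by (rule failure_bound_le) (use k assms in linarith)+
    finally have "measure_pmf.prob (C U k) {cs. fails [] [] cs} \<le> 1 / real k" .
    moreover have "(\<lambda>cs. search d U k cs []) -` {t. solves_hitting_set U E k (output_of orc t)} =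
        - {cs. fails [] [] cs}"
      by (auto simp: fails_def output_of_def)
    then have "measure_pmf.prob (Alg U k) {t. solves_hitting_set U E k (output_of orc t)} =
        measure_pmf.prob (C U k) (- {cs. fails [] [] cs})"
      by (simp add: Alg_def)
    moreover have "measure_pmf.prob (C U k) (- {cs. fails [] [] cs}) =
        1 - measure_pmf.prob (C U k) {cs. fails [] [] cs}"
      unfolding Compl_eq_Diff_UNIV
      by (rule measure_pmf.prob_compl[unfolded space_measure_pmf]) simp
    ultimately show ?thesis using k by simp
  qed
  show ?thesis
    using queries success num_tests_bigo[of d] zero_less_one by blast
qed

end
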